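(* Let $\mathcal{G}=(\mathcal{V},\mathcal{E})$ be a finite undirected graph and consider a Neighbourhood Transformer layer on $\mathcal{G}$ (as defined in the context), mapping input node representations $H'\in\mathbb{R}^{|\mathcal{V}|\times d}$ to output representations $H$. Suppose the combiner uses only the information from the central nodes of neighbourhoods, i.e. the combiner's value on $[H'_{j,:}\;\;H'_{k,:}]$ depends only on $H'_{j,:}$ (the representation of the central node $v_j$ of the neighbourhood $\mathcal{N}(v_j)$) and not on $H'_{k,:}$. Then the Neighbourhood Transformer layer $H'\mapsto H$ is a message passing layer on $\mathcal{G}$.
   Context: Graph notation: $\mathcal{V}=\{v_1,\dots,v_{|\mathcal{V}|}\}$; $\mathcal{N}(v_i)=\{v_j : v_i \text{ is connected to } v_j\}$ is the neighbourhood of $v_i$, with $v_i$ called its central node; since the graph is undirected, $v_j\in\mathcal{N}(v_i)$ iff $v_i\in\mathcal{N}(v_j)$. $X_{i,:}$ denotes the $i$-th row of a matrix $X$ and is attached to node $v_i$. $\phi:\mathbb{R}\to\mathbb{R}$ is an activation function, applied entrywise. Message passing layer: a map sending node features $X$ (one row per node) to $H$ of the form $Z_{j,:}=\phi(\mathrm{Combiner}(X_{j,:}))$, $H_{i,:}=\mathrm{Aggregator}(\{Z_{j,:} : v_j\in\mathcal{N}(v_i)\})$, where Combiner is a function applied to each node's feature vector separately and Aggregator is an order-invariant function of a finite collection (multiset) of vectors. Self-attention: for a matrix $X$ with $n$ rows, fixed parameter matrices $W_q,W_k,W_v$ with $h$ columns, $Q=XW_q$, $K=XW_k$, $V=XW_v$,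 and $\mathrm{SelfAttention}(X)=\mathrm{softmax}\big(QK^T/\sqrt{h}\big)\,V$, where softmax is applied to each row. Neighbourhood Transformer layer: given input $H'$, a combiner function, parameters of SelfAttention, $\phi$, and an order-invariant Aggregator on multisets of vectors, the output $H$ is computed by $Z_{(j,k),:}=\phi(\mathrm{Combiner}([H'_{j,:}\;\;H'_{k,:}]))$ for $v_k\in\mathcal{N}(v_j)$; $M^{(j)}=\phi(\mathrm{SelfAttention}(\oplus\{Z_{(j,k),:} : v_k\in\mathcal{N}(v_j)\}))$, where $\oplus$ stacks row vectors into a matrix (one row for each $v_k\in\mathcal{N}(v_j)$); $H_{i,:}=\mathrm{Aggregator}(\{M^{(j)}_{(i),:} : v_j\in\mathcal{N}(v_i)\})$, where $M^{(j)}_{(i),:}$ is the row of $M^{(j)}$ corresponding to node $v_i\in\mathcal{N}(v_j)$. *)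

theory Defs
  imports
    Complex_Main
    "HOL-Library.Multiset"
    "HOL-Library.FuncSet"
    "Graph_Theory.Pair_Digraph"
    "Jordan_Normal_Form.Matrix"
begin

text \<open>
  Undirected graphs are symmetric pair digraphs whose vertices are
  \<^term>\<open>{0..<n}\<close>, so that the vertices index the rows of a feature
  matrix. An undirected edge is a pair of opposite arcs.
\<close>

definition nbhd :: "nat pair_pre_digraph \<Rightarrow> nat \<Rightarrow> nat set" where
  "nbhd G i = {j. (i, j) \<in> parcs G}"

definition multisets_over :: "'a set \<Rightarrow> 'a multiset set" where
  "multisets_over A = {S. set_mset S \<subseteq> A}"

text \<open>
  Order invariance of an aggregator is expressed by its type: its argument is a
  finite multiset of vectors. The combiner, the aggregator and the hidden
  dimension \<open>m\<close> are the same for all nodes and all inputs.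
\<close>

definition message_passing_layer ::
  "nat pair_pre_digraph \<Rightarrow> (real \<Rightarrow> real) \<Rightarrow> nat \<Rightarrow> nat \<Rightarrow> (real mat \<Rightarrow> real mat) \<Rightarrow> bool"
  where
  "message_passing_layer G \<phi> d p L \<longleftrightarrow>
    (\<exists>m. \<exists>combiner \<in> carrier_vec d \<rightarrow> carrier_vec m.
      \<exists>aggregator \<in> multisets_over (carrier_vec m) \<rightarrow> carrier_vec p.
       \<forall>X \<in> carrier_mat (card (pverts G)) d.
         L X \<in> carrier_mat (card (pverts G)) p \<and>
         (\<forall>i \<in> pverts G. row (L X) i =
            aggregator {# map_vec \<phi> (combiner (row X j)). j \<in># mset_set (nbhd G i) #}))"

definition softmax :: "real mat \<Rightarrow> real mat" where
  "softmax A = mat (dim_row A) (dim_col A)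
    (\<lambda>(i, j). exp (A $$ (i, j)) / (\<Sum>k<dim_col A. exp (A $$ (i, k))))"

definition self_attention :: "real mat \<Rightarrow> real mat \<Rightarrow> real mat \<Rightarrow> real mat \<Rightarrow> real mat" where
  "self_attention Wq Wk Wv X =
    (let Q = X * Wq; K = X * Wk; V = X * Wv; h = dim_col Wq
     in softmax ((1 / sqrt (real h)) \<cdot>\<^sub>m (Q * transpose_mat K)) * V)"

text \<open>
  The rows of a stacked neighbourhood matrix are ordered by increasing node index.
\<close>

definition nbhd_list :: "nat pair_pre_digraph \<Rightarrow> nat \<Rightarrow> nat list" where
  "nbhd_list G j = sorted_list_of_set (nbhd G j)"

definition row_index :: "nat pair_pre_digraph \<Rightarrow> nat \<Rightarrow> nat \<Rightarrow> nat" where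
  "row_index G j i = (THE r. r < length (nbhd_list G j) \<and> nbhd_list G j ! r = i)"

definition nt_message ::
  "(real \<Rightarrow> real) \<Rightarrow> (real vec \<Rightarrow> real vec) \<Rightarrow> real mat \<Rightarrow> nat \<Rightarrow> nat \<Rightarrow> real vec" where
  "nt_message \<phi> combiner X j k = map_vec \<phi> (combiner (row X j @\<^sub>v row X k))"

definition nt_nbhd_matrix ::
  "nat pair_pre_digraph \<Rightarrow> (real \<Rightarrow> real) \<Rightarrow> (real vec \<Rightarrow> real vec) \<Rightarrow>
   real mat \<Rightarrow> real mat \<Rightarrow> real mat \<Rightarrow> real mat \<Rightarrow> nat \<Rightarrow> real mat" where
  "nt_nbhd_matrix G \<phi> combiner Wq Wk Wv X j =
    map_mat \<phi> (self_attention Wq Wk Wv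
      (mat_of_rows (dim_row Wq) (map (nt_message \<phi> combiner X j) (nbhd_list G j))))"

text \<open>The argument \<open>p\<close> is the number of columns of the output.\<close>

definition nt_layer ::
  "nat pair_pre_digraph \<Rightarrow> (real \<Rightarrow> real) \<Rightarrow> (real vec \<Rightarrow> real vec) \<Rightarrow>
   real mat \<Rightarrow> real mat \<Rightarrow> real mat \<Rightarrow> nat \<Rightarrow> (real vec multiset \<Rightarrow> real vec) \<Rightarrow>
   real mat \<Rightarrow> real mat" where
  "nt_layer G \<phi> combiner Wq Wk Wv p aggregator X =
    mat_of_rows p (map (\<lambda>i. aggregator
       {# row (nt_nbhd_matrix G \<phi> combiner Wq Wk Wv X j) (row_index G j i).
          j \<in># mset_set (nbhd G i) #}) [0..<card (pverts G)])"

definition uses_only_central :: "nat \<Rightarrow> (real vec \<Rightarrow> real vec) \<Rightarrow> bool" where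
  "uses_only_central d combiner \<longleftrightarrow>
    (\<forall>x \<in> carrier_vec d. \<forall>y \<in> carrier_vec d. \<forall>y' \<in> carrier_vec d.
       combiner (x @\<^sub>v y) = combiner (x @\<^sub>v y'))"

end

theory Submission
  imports Defs
begin

text \<open>
  If the combiner ignores the neighbour, all rows stacked for \<open>\<N>(v\<^sub>j)\<close> are one vector \<open>z\<^sub>j\<close>, so
  all rows of the value matrix are \<open>z\<^sub>j W\<^sub>v\<close>. A softmax row is a convex combination, hence every
  row of the attention output is again \<open>z\<^sub>j W\<^sub>v\<close>, whichever node it belongs to. The layer is thus a
  message passing layer whose combiner sends the row \<open>x\<close> of \<open>v\<^sub>j\<close> to \<open>z\<^sub>j W\<^sub>v\<close>.
\<close>

lemma softmax_dim [simp]: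
  "dim_row (softmax A) = dim_row A" "dim_col (softmax A) = dim_col A"
  by (simp_all add: softmax_def)

text \<open>With no columns the sum would be empty and equal to 0, so positivity of
  \<open>dim_col A\<close> is essential; it is traced below to a neighbourhood being
  nonempty.\<close>

lemma sum_softmax_row:
  assumes "r < dim_row A" "0 < dim_col A"
  shows "(\<Sum>k = 0..<dim_col A. softmax A $$ (r, k)) = 1"
proof -
  have "0 < (\<Sum>k<dim_col A. exp (A $$ (r, k)))"
    using assms(2) by (intro sum_pos) auto
  moreover have "(\<Sum>k = 0..<dim_col A. softmax A $$ (r, k)) =
      (\<Sum>k<dim_col A. exp (A $$ (r, k)) / (\<Sum>l<dim_col A. exp (A $$ (r, l))))"
    unfolding atLeast0LessThan using assms(1) by (intro sum.cong) (auto simp: softmax_def)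
  ultimately show ?thesis
    by (simp flip: sum_divide_distrib)
qed

lemma row_softmax_mult_equal_rows:
  assumes V: "V \<in> carrier_mat (dim_col A) c"
    and rows: "\<And>k. k < dim_col A \<Longrightarrow> row V k = w"
    and r: "r < dim_row A" and pos: "0 < dim_col A"
  shows "row (softmax A * V) r = w"
proof (rule eq_vecI)
  have w: "w \<in> carrier_vec c"
    using V rows[OF pos] by auto
  then show "dim_vec (row (softmax A * V) r) = dim_vec w"
    using V by simp
  fix l assume "l < dim_vec w"
  then have l: "l < c" using w by simp
  have entry: "V $$ (k, l) = w $ l" if "k < dim_col A" for k
    using V that l rows[OF that] by (metis carrier_matD index_row(1))
  have "row (softmax A * V) r $ l = (\<Sum>k = 0..<dim_col A. softmax A $$ (r, k) * V $$ (k, l))"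
    using V r l by (auto simp: scalar_prod_def intro!: sum.cong)
  also have "\<dots> = (\<Sum>k = 0..<dim_col A. softmax A $$ (r, k)) * w $ l"
    by (simp add: entry sum_distrib_right)
  finally show "row (softmax A * V) r $ l = w $ l"
    by (simp add: sum_softmax_row[OF r pos])
qed

lemma self_attention_carrier:
  assumes "X \<in> carrier_mat k m" "Wv \<in> carrier_mat m c"
  shows "self_attention Wq Wk Wv X \<in> carrier_mat k c"
  using assms by (intro carrier_matI) (auto simp: self_attention_def Let_def)

text \<open>Queries and keys affect only the softmax weights, over which a constant value row
  averages to itself. That row, z times \<open>Wv\<close>, is written with the transpose because
  vectors here multiply matrices from the right.\<close>

lemma row_self_attention_equal_rows:
  assumes X: "X \<in> carrier_mat k m" and Wv: "Wv \<in> carrier_mat m c"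
    and rows: "\<And>r. r < k \<Longrightarrow> row X r = z" and r: "r < k"
  shows "row (self_attention Wq Wk Wv X) r = transpose_mat Wv *\<^sub>v z"
  unfolding self_attention_def Let_def
proof (rule row_softmax_mult_equal_rows)
  have z: "z \<in> carrier_vec m"
    using X rows[OF r] by auto
  show "row (X * Wv) l = transpose_mat Wv *\<^sub>v z"
    if "l < dim_col ((1 / sqrt (real (dim_col Wq))) \<cdot>\<^sub>m (X * Wq * transpose_mat (X * Wk)))" for l
    \<comment> \<open>Entrywise, both sides are the scalar product of \<open>z\<close> with a column
      of \<open>Wv\<close>, in opposite orders.\<close>
    using that X Wv z rows
    by (intro eq_vecI) (auto simp: comm_scalar_prod[OF z])
qed (use X Wv r in auto)

text \<open>The sorted list of a finite set is distinct and contains \<open>i\<close>, so the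
  \<open>THE\<close> is well defined. Since all rows will agree, the bound suffices and the exact
  position is irrelevant.\<close>

lemma row_index_bound:
  assumes "finite (nbhd G j)" "i \<in> nbhd G j"
  shows "row_index G j i < length (nbhd_list G j)"
proof -
  have "\<exists>!r. r < length (nbhd_list G j) \<and> nbhd_list G j ! r = i"
    using assms by (intro distinct_Ex1) (simp_all add: nbhd_list_def)
  from theI'[OF this] show ?thesis
    by (simp add: row_index_def)
qed

lemma row_map_mat: "r < dim_row A \<Longrightarrow> row (map_mat f A) r = map_vec f (row A r)"
  by (intro eq_vecI) auto

lemma row_nt_nbhd_matrix_central:
  assumes "finite (nbhd G j)" "i \<in> nbhd G j" "Wq \<in> carrier_mat m h" "Wv \<in> carrier_mat m c"
    and msg: "\<And>k. k \<in> nbhd G j \<Longrightarrow> nt_message \<phi> combiner X j k = z"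
    and z: "z \<in> carrier_vec m"
  shows "row (nt_nbhd_matrix G \<phi> combiner Wq Wk Wv X j) (row_index G j i) =
    map_vec \<phi> (transpose_mat Wv *\<^sub>v z)"
proof -
  let ?l = "nbhd_list G j"
  let ?Y = "mat_of_rows (dim_row Wq) (map (nt_message \<phi> combiner X j) ?l)"
  have Y: "?Y \<in> carrier_mat (length ?l) m"
    using assms(3) by (auto simp: mat_of_rows_def)
  have rows: "row ?Y r = z" if "r < length ?l" for r
  proof -
    have "?l ! r \<in> nbhd G j"
      using assms(1) nth_mem[OF that] by (simp add: nbhd_list_def)
    with that assms(3) z show ?thesis
      by (subst mat_of_rows_row) (auto simp: msg)
  qed
  \<comment> \<open>This bound also shows that the stacked matrix has at least one row.\<close>
  have r: "row_index G j i < length ?l"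
    using assms(1,2) by (rule row_index_bound)
  then show ?thesis
    unfolding nt_nbhd_matrix_def
    using carrier_matD(1)[OF self_attention_carrier[OF Y assms(4)]]
    by (subst row_map_mat) (simp_all add: row_self_attention_equal_rows[OF Y assms(4) rows r])
qed

theorem theorem1:
  fixes G :: "nat pair_pre_digraph"
    and n d m h p :: nat
    and \<phi> :: "real \<Rightarrow> real"
    and combiner :: "real vec \<Rightarrow> real vec"
    and Wq Wk Wv :: "real mat"
    and aggregator :: "real vec multiset \<Rightarrow> real vec"
  assumes "pair_pseudo_graph G" and "pverts G = {0..<n}"
    and "combiner \<in> carrier_vec (d + d) \<rightarrow> carrier_vec m"
    and "0 < h"
    and "Wq \<in> carrier_mat m h" and "Wk \<in> carrier_mat m h" and "Wv \<in> carrier_mat m h"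
    and "aggregator \<in> multisets_over (carrier_vec h) \<rightarrow> carrier_vec p"
    and "uses_only_central d combiner"
  shows "message_passing_layer G \<phi> d p (nt_layer G \<phi> combiner Wq Wk Wv p aggregator)"
proof -
  interpret pair_pseudo_graph G by fact
  \<comment> \<open>The zero vector is an arbitrary filler for the neighbour's half of the
    input.\<close>
  let ?z = "\<lambda>x. map_vec \<phi> (combiner (x @\<^sub>v 0\<^sub>v d))"
  \<comment> \<open>The inner activation and the value projection are absorbed into the new
    combiner; the activation after attention becomes that of the message passing layer.\<close>
  let ?comb = "\<lambda>x. transpose_mat Wv *\<^sub>v ?z x"
  let ?L = "nt_layer G \<phi> combiner Wq Wk Wv p aggregator"
  have card: "card (pverts G) = n" using assms(2) by simp
  have sub: "nbhd G i \<subseteq> {0..<n}" for i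
    using in_arcsD2 assms(2) by (auto simp: nbhd_def)
  have fin: "finite (nbhd G i)" for i
    using finite_subset[OF sub] by simp
  \<comment> \<open>Undirectedness ensures that node \<open>i\<close> owns a row in the matrix of
    each neighbour \<open>j\<close>.\<close>
  have sym: "i \<in> nbhd G j" if "j \<in> nbhd G i" for i j
    using that arcs_symmetric by (simp add: nbhd_def)
  have z: "?z x \<in> carrier_vec m" if "x \<in> carrier_vec d" for x
    using that assms(3) by (auto simp: Pi_iff)
  have comb: "?comb x \<in> carrier_vec h" for x
    using assms(7) by (auto intro!: carrier_vecI)
  have msgs: "{# row (nt_nbhd_matrix G \<phi> combiner Wq Wk Wv X j) (row_index G j i).
      j \<in># mset_set (nbhd G i) #} =
    {# map_vec \<phi> (?comb (row X j)). j \<in># mset_set (nbhd G i) #}"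
    if X: "X \<in> carrier_mat n d" for X i
  proof (rule image_mset_cong)
    fix j assume "j \<in># mset_set (nbhd G i)"
    then have j: "j \<in> nbhd G i" using fin by simp
    \<comment> \<open>Holds for any index \<open>k\<close>, because the length of a row is the
      column count of \<open>X\<close>.\<close>
    have row: "row X k \<in> carrier_vec d" for k
      using X by auto
    have "nt_message \<phi> combiner X j k = ?z (row X j)" for k
    proof -
      have "combiner (row X j @\<^sub>v row X k) = combiner (row X j @\<^sub>v 0\<^sub>v d)"
        using assms(9) row zero_carrier_vec unfolding uses_only_central_def by blast
      then show ?thesis by (simp add: nt_message_def)
    qed
    with fin sym[OF j] assms(5,7) z[OF row]
    show "row (nt_nbhd_matrix G \<phi> combiner Wq Wk Wv X j) (row_index G j i) =
        map_vec \<phi> (?comb (row X j))"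
      by (intro row_nt_nbhd_matrix_central)
  qed
  \<comment> \<open>Length \<open>p\<close> is what lets \<open>mat_of_rows_row\<close> recover each
    aggregated vector as a row of the output.\<close>
  have agg: "aggregator {# map_vec \<phi> (?comb (row X j)). j \<in># mset_set (nbhd G i) #}
      \<in> carrier_vec p" for X i
    using comb by (intro funcset_mem[OF assms(8)]) (auto simp: multisets_over_def)
  have "?L X \<in> carrier_mat n p \<and> (\<forall>i \<in> pverts G. row (?L X) i =
      aggregator {# map_vec \<phi> (?comb (row X j)). j \<in># mset_set (nbhd G i) #})"
    if X: "X \<in> carrier_mat n d" for X
    unfolding nt_layer_def card msgs[OF X] assms(2)
    using agg[of X] by (auto simp: mat_of_rows_row intro: carrier_matI)
  then show ?thesis
    unfolding message_passing_layer_def card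
    \<comment> \<open>The hidden dimension is \<open>h\<close>, the width after the value
      projection, rather than \<open>m\<close>; the aggregator is kept.\<close>
    using comb assms(8) by (intro exI[of _ h] bexI[of _ ?comb] bexI[of _ aggregator]) auto
qed

end
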